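(* Let $A,E\in\mathbb{C}^{n,n}$, let $L(s)=A+sE$ be a regular pencil, and let $(\lambda_1,\dots,\lambda_{n+1})\in\mathcal{K}$. Then $$\delta(A,E)^2\ \ge\ \max_{i=1,\dots,n+1}\frac{1}{\lambda_{\max}(H_i)},$$ where, for each $i=1,\dots,n+1$, $M_i=(L(\lambda_i))^{-1}$ and $$H_i=\begin{bmatrix}I_n\\ \bar\lambda_iI_n\end{bmatrix}M_i^*M_i\begin{bmatrix}I_n&\lambda_iI_n\end{bmatrix}.$$
   Context: $\mathbb{C}^{n,n}$ is the set of complex $n\times n$ matrices. A pencil $L(s)=A+sE$ is regular if $L(\lambda)$ is invertible for some $\lambda\in\mathbb{C}$. $\|\cdot\|$ is the spectral norm and $\lambda_{\max}(H)$ is the largest eigenvalue of a Hermitian matrix $H$. The set $$\mathcal{K}=\{(\lambda_1,\dots,\lambda_{n+1})\in\mathbb{C}^{n+1}\;:\;\lambda_i\neq\lambda_j \text{ for } i\neq j,\ L(\lambda_i)\text{ invertible for all } i=1,\dots,n+1\}.$$ The unstructured distance to singularity is $$\delta(A,E)=\inf\Big\{\sqrt{\|\Delta_A\|^2+\|\Delta_E\|^2}\;:\;\Delta_A,\Delta_E\in\mathbb{C}^{n,n},\ \det\big((A-\Delta_A)+\lambda(E-\Delta_E)\big)=0\text{ for all }\lambda\in\mathbb{C}\Big\}.$$ *)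

theory Defs
  imports "HOL-Analysis.Analysis"
begin

definition pencil :: "complex^'n^'n \<Rightarrow> complex^'n^'n \<Rightarrow> complex \<Rightarrow> complex^'n^'n" where
  "pencil A E s = A + map_matrix (\<lambda>x. s * x) E"

definition regular_pencil :: "complex^'n^'n \<Rightarrow> complex^'n^'n \<Rightarrow> bool" where
  "regular_pencil A E \<longleftrightarrow> (\<exists>l. invertible (pencil A E l))"

(* The norm on complex^'n is the Euclidean one, so the induced operator norm is the
   spectral norm. *)
definition spectral_norm :: "complex^'n^'m \<Rightarrow> real" where
  "spectral_norm A = onorm (\<lambda>x. A *v x)"

definition conj_transpose :: "complex^'n^'m \<Rightarrow> complex^'m^'n" where
  "conj_transpose A = map_matrix cnj (transpose A)"

definition eigenvalue :: "complex^'n^'n \<Rightarrow> complex \<Rightarrow> bool" where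
  "eigenvalue H \<mu> \<longleftrightarrow> (\<exists>v. v \<noteq> 0 \<and> H *v v = \<mu> *s v)"

(* Meant for Hermitian H only, where every eigenvalue is real; restricting to real r
   then loses nothing. *)
definition lambda_max :: "complex^'n^'n \<Rightarrow> real" where
  "lambda_max H = Max {r :: real. eigenvalue H (complex_of_real r)}"

(* Tuples of n + 1 points are functions on nat, of which only the values at the indices
   1, ..., n + 1 matter; here n = CARD('n). *)
definition K_set :: "complex^'n^'n \<Rightarrow> complex^'n^'n \<Rightarrow> (nat \<Rightarrow> complex) set" where
  "K_set A E = {l. (\<forall>i\<in>{1..CARD('n) + 1}. \<forall>j\<in>{1..CARD('n) + 1}. i \<noteq> j \<longrightarrow> l i \<noteq> l j) \<and>
                   (\<forall>i\<in>{1..CARD('n) + 1}. invertible (pencil A E (l i)))}"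

(* The set is nonempty (take DA = A, DE = E) and bounded below by 0, so Inf is the
   genuine infimum. *)
definition dist_sing :: "complex^'n^'n \<Rightarrow> complex^'n^'n \<Rightarrow> real" where
  "dist_sing A E = Inf {sqrt ((spectral_norm DA)\<^sup>2 + (spectral_norm DE)\<^sup>2) | DA DE.
                          \<forall>l. det (pencil (A - DA) (E - DE) l) = 0}"

(* Block matrices [X; Y] and [X Y], with the sum type 'n + 'n as the index set of size 2n. *)
definition block_col :: "complex^'m^'n \<Rightarrow> complex^'m^'n \<Rightarrow> complex^'m^('n + 'n)" where
  "block_col X Y = (\<chi> i j. case i of Inl k \<Rightarrow> X $ k $ j | Inr k \<Rightarrow> Y $ k $ j)"

definition block_row :: "complex^'n^'m \<Rightarrow> complex^'n^'m \<Rightarrow> complex^('n + 'n)^'m" where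
  "block_row X Y = (\<chi> i j. case j of Inl k \<Rightarrow> X $ i $ k | Inr k \<Rightarrow> Y $ i $ k)"

definition H_mat :: "complex^'n^'n \<Rightarrow> complex^'n^'n \<Rightarrow> complex \<Rightarrow> complex^('n + 'n)^('n + 'n)" where
  "H_mat A E l =
     (let M = matrix_inv (pencil A E l)
      in block_col (mat 1) (mat (cnj l)) ** (conj_transpose M ** M) ** block_row (mat 1) (mat l))"

end

theory Submission
  imports Defs
begin

text \<open>
  Fix one point \<open>\<lambda>\<close> at which \<open>L(\<lambda>)\<close> is invertible, and put \<open>M = L(\<lambda>)\<^sup>-\<^sup>1\<close> and
  \<open>N = M [I, \<lambda> I]\<close>. Then \<open>H = N\<^sup>* N\<close> is a Gram matrix, so its largest eigenvalue is at least
  (in fact equal to) \<open>\<parallel>N\<parallel>\<^sup>2\<close>. If the perturbed pencil is singular, it has at this \<open>\<lambda>\<close> a kernel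
  vector \<open>v \<noteq> 0\<close>, that is, \<open>L(\<lambda>) v = \<Delta>\<^sub>A v + \<lambda> \<Delta>\<^sub>E v\<close>, or \<open>v = N w\<close> for the stacked vector
  \<open>w = (\<Delta>\<^sub>A v, \<Delta>\<^sub>E v)\<close>. Since \<open>\<parallel>w\<parallel>\<^sup>2 \<le> (\<parallel>\<Delta>\<^sub>A\<parallel>\<^sup>2 + \<parallel>\<Delta>\<^sub>E\<parallel>\<^sup>2) \<parallel>v\<parallel>\<^sup>2\<close>, it follows that
  \<open>1 \<le> \<lambda>\<^sub>m\<^sub>a\<^sub>x(H) (\<parallel>\<Delta>\<^sub>A\<parallel>\<^sup>2 + \<parallel>\<Delta>\<^sub>E\<parallel>\<^sup>2)\<close>
  (\<open>one_le_lambda_max_mult_perturbation\<close>). Passing to the infimum over all singular perturbations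
  bounds the distance by this one point, and the maximum is taken over points that can be treated
  one at a time.

  The bound \<open>\<parallel>N\<parallel>\<^sup>2 \<le> \<lambda>\<^sub>m\<^sub>a\<^sub>x(N\<^sup>* N)\<close> (\<open>spectral_norm_squared_le_lambda_max\<close>) has two
  ingredients. A unit vector at which \<open>N\<close> attains its norm is an eigenvector of \<open>N\<^sup>* N\<close> for
  \<open>\<parallel>N\<parallel>\<^sup>2\<close>; and a Hermitian matrix has only finitely many eigenvalues, so that the maximum over
  its real eigenvalues is meaningful. Both are proved in \<open>\<complex>\<^sup>n\<close> regarded as a real Euclidean
  space, whose inner product is the real part of the Hermitian one.
\<close>

section \<open>The largest eigenvalue of a Gram matrix\<close>

text \<open>
  The conjugate transpose is the adjoint even for the real inner product, because multiplication
  by a complex number \<open>a\<close> has multiplication by its conjugate as adjoint on the real plane.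
\<close>

lemma inner_conj_transpose:
  fixes N :: "complex^'n^'m"
  shows "(N *v x) \<bullet> y = x \<bullet> (conj_transpose N *v y)"
proof -
  have shift: "(a * b) \<bullet> c = b \<bullet> (cnj a * c)" for a b c :: complex
    by (simp add: inner_complex_def algebra_simps)
  have "(N *v x) \<bullet> y = (\<Sum>i\<in>UNIV. \<Sum>j\<in>UNIV. (N $ i $ j * x $ j) \<bullet> (y $ i))"
    by (simp add: inner_vec_def matrix_vector_mult_def inner_sum_left)
  also have "\<dots> = (\<Sum>j\<in>UNIV. \<Sum>i\<in>UNIV. (x $ j) \<bullet> (cnj (N $ i $ j) * y $ i))"
    by (subst sum.swap) (simp only: shift)
  also have "\<dots> = x \<bullet> (conj_transpose N *v y)"
    by (simp add: inner_vec_def matrix_vector_mult_def inner_sum_right conj_transpose_def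
        transpose_def map_matrix_def)
  finally show ?thesis .
qed

lemma conj_transpose_conj_transpose [simp]: "conj_transpose (conj_transpose N) = N"
  by (simp add: conj_transpose_def transpose_def map_matrix_def vec_eq_iff)

lemma conj_transpose_mult: "conj_transpose (N ** P) = conj_transpose P ** conj_transpose N"
  by (simp add: conj_transpose_def transpose_def map_matrix_def vec_eq_iff matrix_matrix_mult_def
      mult.commute)

text \<open>
  For real eigenvalues the complex scaling is a real one, which puts the eigenvalue equation in
  the form that the real inner product can handle.
\<close>

lemma eigenvalue_real_iff:
  "eigenvalue H (complex_of_real r) \<longleftrightarrow> (\<exists>v. v \<noteq> 0 \<and> H *v v = r *\<^sub>R v)"
proof -
  have "complex_of_real r *s v = r *\<^sub>R v" for v :: "complex^'a"
    by (simp add: vec_eq_iff scaleR_conv_of_real[where 'a = complex])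
  then show ?thesis by (simp add: eigenvalue_def)
qed

text \<open>
  Eigenvectors for distinct real eigenvalues are orthogonal, and a Euclidean space contains only
  finitely many pairwise orthogonal vectors.
\<close>

lemma finite_real_eigenvalues_hermitian:
  fixes H :: "complex^'n^'n"
  assumes "conj_transpose H = H"
  shows "finite {r. eigenvalue H (complex_of_real r)}" (is "finite ?S")
proof -
  have "\<forall>r\<in>?S. \<exists>v. v \<noteq> 0 \<and> H *v v = r *\<^sub>R v" by (simp add: eigenvalue_real_iff)
  from bchoice[OF this] obtain f
    where f: "\<And>r. r \<in> ?S \<Longrightarrow> f r \<noteq> 0 \<and> H *v f r = r *\<^sub>R f r" by blast
  have orth: "f r \<bullet> f s = 0" if "r \<in> ?S" "s \<in> ?S" "r \<noteq> s" for r s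
  proof -
    have "r * (f r \<bullet> f s) = (H *v f r) \<bullet> f s" using f that by simp
    also have "\<dots> = f r \<bullet> (H *v f s)" by (simp add: inner_conj_transpose assms)
    also have "\<dots> = s * (f r \<bullet> f s)" using f that by simp
    finally show ?thesis using that by simp
  qed
  have "inj_on f ?S"
  proof (rule inj_onI, rule ccontr)
    fix r s assume rs: "r \<in> ?S" "s \<in> ?S" "f r = f s" "r \<noteq> s"
    then have "f r \<bullet> f r = 0" using orth[of r s] by simp
    then show False using f[OF rs(1)] by simp
  qed
  moreover have "pairwise orthogonal (f ` ?S)"
    using orth by (auto simp: pairwise_def orthogonal_def)
  then have "finite (f ` ?S)" by (rule pairwise_orthogonal_imp_finite)
  ultimately show ?thesis by (rule finite_imageD[rotated])
qed

lemma norm_matrix_vector_le: "norm (N *v x) \<le> spectral_norm N * norm x" for N :: "complex^'n^'m"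
  unfolding spectral_norm_def by (rule onorm) simp

lemma spectral_norm_nonneg: "0 \<le> spectral_norm N" for N :: "complex^'n^'m"
  unfolding spectral_norm_def by (rule onorm_pos_le) simp

text \<open>
  The unit sphere is compact in finite dimension, so the norm of the image has a maximum there;
  homogeneity extends that bound to all vectors.
\<close>

lemma spectral_norm_attained:
  fixes N :: "complex^'n^'m"
  obtains w where "norm w = 1" "norm (N *v w) = spectral_norm N"
proof -
  have "axis undefined 1 \<in> sphere (0 :: complex^'n) 1" by simp
  then have "sphere (0 :: complex^'n) 1 \<noteq> {}" by blast
  moreover have "continuous_on (sphere 0 1) (\<lambda>x. norm (N *v x))"
    by (intro continuous_intros linear_continuous_on) simp
  ultimately obtain w where w: "w \<in> sphere 0 1"
    and max: "\<And>y. y \<in> sphere 0 1 \<Longrightarrow> norm (N *v y) \<le> norm (N *v w)"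
    using continuous_attains_sup[OF compact_sphere] by blast
  have bound: "norm (N *v x) \<le> norm (N *v w) * norm x" for x
  proof (cases "x = 0")
    case False
    have "norm (N *v (x /\<^sub>R norm x)) = norm (N *v x) / norm x"
      by (simp add: linear_scale[OF matrix_vector_mul_linear] divide_inverse_commute)
    with max[of "x /\<^sub>R norm x"] False show ?thesis by (simp add: divide_le_eq)
  qed simp
  have "spectral_norm N = norm (N *v w)"
    using onorm_le[OF bound] norm_matrix_vector_le[of N w] w by (simp add: spectral_norm_def)
  with w that show thesis by simp
qed

text \<open>
  An adjoint is bounded by the norm of the original map: with \<open>z = N\<^sup>* y\<close>, Cauchy--Schwarz gives
  \<open>\<parallel>z\<parallel>\<^sup>2 = \<langle>N z, y\<rangle> \<le> \<parallel>N\<parallel> \<parallel>z\<parallel> \<parallel>y\<parallel>\<close>.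
\<close>

lemma norm_conj_transpose_mult_le:
  fixes N :: "complex^'n^'m"
  shows "norm (conj_transpose N *v y) \<le> spectral_norm N * norm y"
proof -
  let ?z = "conj_transpose N *v y"
  have "norm ?z * norm ?z = (N *v ?z) \<bullet> y"
    by (simp add: inner_conj_transpose flip: power2_norm_eq_inner power2_eq_square)
  also have "\<dots> \<le> norm (N *v ?z) * norm y" by (rule norm_cauchy_schwarz)
  also have "\<dots> \<le> spectral_norm N * norm ?z * norm y"
    by (intro mult_right_mono norm_matrix_vector_le) simp
  finally have "norm ?z * norm ?z \<le> norm ?z * (spectral_norm N * norm y)" by (simp add: ac_simps)
  then show ?thesis
    by (cases "?z = 0") (simp_all add: spectral_norm_nonneg)
qed

text \<open>
  Let the unit vector \<open>w\<close> attain the norm \<open>\<sigma>\<close> of \<open>N\<close>, and let \<open>u = N\<^sup>* N w\<close>. Then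
  \<open>\<langle>u, w\<rangle> = \<parallel>N w\<parallel>\<^sup>2 = \<sigma>\<^sup>2\<close> while \<open>\<parallel>u\<parallel> \<le> \<sigma>\<^sup>2\<close>: this is the equality case of Cauchy--Schwarz,
  which forces \<open>u = \<sigma>\<^sup>2 w\<close>.
\<close>

lemma eigenvalue_spectral_norm_squared:
  fixes N :: "complex^'n^'m"
  shows "eigenvalue (conj_transpose N ** N) (complex_of_real ((spectral_norm N)\<^sup>2))"
proof -
  let ?s = "spectral_norm N"
  obtain w where w: "norm w = 1" "norm (N *v w) = ?s" by (rule spectral_norm_attained)
  let ?u = "conj_transpose N *v (N *v w)"
  have uw: "?u \<bullet> w = ?s\<^sup>2"
    using w by (simp add: inner_conj_transpose[of "conj_transpose N"] flip: power2_norm_eq_inner)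
  have "norm ?u \<le> ?s * ?s"
    using norm_conj_transpose_mult_le[of N "N *v w"] w by simp
  then have u: "(norm ?u)\<^sup>2 \<le> (?s\<^sup>2)\<^sup>2"
    using power_mono[of "norm ?u" "?s\<^sup>2" 2] by (simp add: power2_eq_square[of ?s])
  have "(norm (?u - ?s\<^sup>2 *\<^sub>R w))\<^sup>2 = (norm ?u)\<^sup>2 - 2 * ?s\<^sup>2 * (?u \<bullet> w) + (?s\<^sup>2)\<^sup>2 * (norm w)\<^sup>2"
    unfolding power2_norm_eq_inner
    by (simp add: inner_simps inner_commute power2_eq_square algebra_simps)
  also have "\<dots> \<le> 0" using u uw w by (simp add: power2_eq_square)
  finally have "?u = ?s\<^sup>2 *\<^sub>R w" by simp
  moreover have "w \<noteq> 0" using w by auto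
  ultimately show ?thesis
    unfolding eigenvalue_real_iff matrix_vector_mul_assoc[symmetric] by blast
qed

text \<open>
  This converts the bound on vectors given by the operator norm into one in terms of eigenvalues.
  Finiteness matters here: without it \<open>Max\<close> would carry no information.
\<close>

lemma spectral_norm_squared_le_lambda_max:
  "(spectral_norm N)\<^sup>2 \<le> lambda_max (conj_transpose N ** N)" for N :: "complex^'n^'m"
  unfolding lambda_max_def
proof (rule Max_ge)
  show "finite {r. eigenvalue (conj_transpose N ** N) (complex_of_real r)}"
    by (rule finite_real_eigenvalues_hermitian) (simp add: conj_transpose_mult)
  show "(spectral_norm N)\<^sup>2 \<in> {r. eigenvalue (conj_transpose N ** N) (complex_of_real r)}"
    using eigenvalue_spectral_norm_squared by blast
qed

section \<open>Block matrices and the Gram form of \<open>H\<close>\<close>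

lemma conj_transpose_block_row:
  "conj_transpose (block_row X Y) = block_col (conj_transpose X) (conj_transpose Y)"
  by (auto simp: vec_eq_iff conj_transpose_def transpose_def map_matrix_def block_row_def
      block_col_def split: sum.split)

lemma conj_transpose_mat: "conj_transpose (mat c) = mat (cnj c)"
  by (auto simp: vec_eq_iff conj_transpose_def transpose_def map_matrix_def mat_def)

text \<open>
  The block column in \<open>H\<close> is the conjugate transpose of the block row, so the product splits
  symmetrically as \<open>(M [I, \<lambda> I])\<^sup>* (M [I, \<lambda> I])\<close>.
\<close>

lemma H_mat_eq_gram:
  "H_mat A E l = conj_transpose (matrix_inv (pencil A E l) ** block_row (mat 1) (mat l))
                  ** (matrix_inv (pencil A E l) ** block_row (mat 1) (mat l))"
  by (simp add: H_mat_def Let_def conj_transpose_mult conj_transpose_block_row conj_transpose_mat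
      matrix_mul_assoc)

lemma lambda_max_H_mat_ge:
  "(spectral_norm (matrix_inv (pencil A E l) ** block_row (mat 1) (mat l)))\<^sup>2
     \<le> lambda_max (H_mat A E l)"
  by (simp add: H_mat_eq_gram spectral_norm_squared_le_lambda_max)

lemma lambda_max_H_mat_nonneg: "0 \<le> lambda_max (H_mat A E l)"
  using lambda_max_H_mat_ge zero_le_power2 by (rule order_trans[rotated])

definition stack :: "complex^'n \<Rightarrow> complex^'n \<Rightarrow> complex^('n + 'n)" where
  "stack a b = (\<chi> i. case i of Inl k \<Rightarrow> a $ k | Inr k \<Rightarrow> b $ k)"

lemma sum_UNIV_Plus:
  fixes f :: "'a::finite + 'b::finite \<Rightarrow> 'c::comm_monoid_add"
  shows "sum f UNIV = (\<Sum>i\<in>UNIV. f (Inl i)) + (\<Sum>i\<in>UNIV. f (Inr i))"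
  using sum.Plus[of "UNIV :: 'a set" "UNIV :: 'b set" f] by simp

lemma norm_stack_squared: "(norm (stack a b))\<^sup>2 = (norm a)\<^sup>2 + (norm b)\<^sup>2"
  by (simp add: power2_norm_eq_inner inner_vec_def stack_def sum_UNIV_Plus)

lemma mat_mult_vector: "mat c *v x = c *s x" for x :: "complex^'n"
  by (simp add: vec_eq_iff matrix_vector_mult_def mat_def if_distrib[of "\<lambda>z. z * _"]
      cong: if_cong)

lemma block_row_mult_stack: "block_row X Y *v stack a b = X *v a + Y *v b"
  by (simp add: vec_eq_iff matrix_vector_mult_def block_row_def stack_def sum_UNIV_Plus)

section \<open>Singular perturbations of a pencil\<close>

lemma pencil_mult_vector: "pencil A E l *v v = A *v v + l *s (E *v v)"
  by (simp add: pencil_def map_matrix_def vec_eq_iff matrix_vector_mult_def sum_distrib_left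
      sum.distrib algebra_simps)

text \<open>
  A kernel vector \<open>v\<close> of the perturbed pencil reproduces itself as \<open>v = N w\<close>, where \<open>w\<close> is built
  from \<open>v\<close> by the perturbation alone. So the norm of \<open>N\<close> and the size of the perturbation cannot
  both be small.
\<close>

lemma one_le_lambda_max_mult_perturbation:
  fixes A E DA DE :: "complex^'n^'n"
  assumes inv: "invertible (pencil A E l)"
    and sing: "det (pencil (A - DA) (E - DE) l) = 0"
  shows "1 \<le> lambda_max (H_mat A E l) * ((spectral_norm DA)\<^sup>2 + (spectral_norm DE)\<^sup>2)"
    (is "1 \<le> ?lam * ?d")
proof -
  let ?M = "matrix_inv (pencil A E l)"
  let ?N = "?M ** block_row (mat 1) (mat l)"
  have left_inv: "?M ** pencil A E l = mat 1"
    using inv unfolding invertible_def matrix_inv_def by (metis (mono_tags, lifting) someI_ex)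
  have "\<not> invertible (pencil (A - DA) (E - DE) l)"
    using sing by (simp add: invertible_det_nz)
  then obtain v where v: "v \<noteq> 0" "pencil (A - DA) (E - DE) l *v v = 0"
    by (metis invertible_left_inverse matrix_left_invertible_ker)
  define w where "w = stack (DA *v v) (DE *v v)"
  have size: "(norm w)\<^sup>2 \<le> ?d * (norm v)\<^sup>2"
  proof -
    have "(norm (D *v v))\<^sup>2 \<le> (spectral_norm D)\<^sup>2 * (norm v)\<^sup>2" for D :: "complex^'n^'n"
      using norm_matrix_vector_le[of D v] by (metis norm_ge_zero power_mono power_mult_distrib)
    from add_mono[OF this this] show ?thesis
      by (simp add: w_def norm_stack_squared distrib_right)
  qed
  have "pencil A E l *v v = DA *v v + l *s (DE *v v)"
    using v(2) by (simp add: pencil_mult_vector algebra_simps matrix_vector_mult_diff_rdistrib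
        vector_sub_rdistrib)
  also have "\<dots> = block_row (mat 1) (mat l) *v w"
    by (simp add: w_def block_row_mult_stack mat_mult_vector)
  finally have "v = ?N *v w"
    by (metis left_inv matrix_vector_mul_assoc matrix_vector_mul_lid)
  then have "(norm v)\<^sup>2 \<le> (spectral_norm ?N)\<^sup>2 * (norm w)\<^sup>2"
    using norm_matrix_vector_le[of ?N w] by (metis norm_ge_zero power_mono power_mult_distrib)
  also have "\<dots> \<le> ?lam * (norm w)\<^sup>2"
    by (intro mult_right_mono lambda_max_H_mat_ge) simp
  also have "\<dots> \<le> ?lam * (?d * (norm v)\<^sup>2)"
    by (intro mult_left_mono size lambda_max_H_mat_nonneg)
  finally have "1 * (norm v)\<^sup>2 \<le> (?lam * ?d) * (norm v)\<^sup>2" by (simp add: mult.assoc)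
  then show ?thesis
    using v(1) by (simp add: mult_le_cancel_right)
qed

text \<open>
  The previous bound holds for every perturbation in the set whose infimum is the distance. That
  set contains the perturbation \<open>(A, E)\<close>, which leaves the zero pencil, so the infimum inherits
  the bound.
\<close>

lemma inverse_lambda_max_le_dist_sing_squared:
  fixes A E :: "complex^'n^'n"
  assumes inv: "invertible (pencil A E l)"
  shows "1 / lambda_max (H_mat A E l) \<le> (dist_sing A E)\<^sup>2"
proof -
  let ?lam = "lambda_max (H_mat A E l)"
  have lam: "0 \<le> ?lam"
    by (rule lambda_max_H_mat_nonneg)
  have "pencil (A - A) (E - E) z = mat 0" for z
    by (simp add: pencil_def map_matrix_def vec_eq_iff mat_def)
  then have trivial: "\<forall>z. det (pencil (A - A) (E - E) z) = 0" by (simp only: det_0 simp_thms)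
  have "sqrt (1 / ?lam) \<le> dist_sing A E"
    unfolding dist_sing_def
  proof (rule cInf_greatest, goal_cases)
    case 1
    then show ?case using trivial by blast
  next
    case (2 x)
    then obtain DA DE where x: "x = sqrt ((spectral_norm DA)\<^sup>2 + (spectral_norm DE)\<^sup>2)"
      and sing: "\<forall>z. det (pencil (A - DA) (E - DE) z) = 0" by blast
    have "1 \<le> ?lam * ((spectral_norm DA)\<^sup>2 + (spectral_norm DE)\<^sup>2)"
      using one_le_lambda_max_mult_perturbation[OF inv] sing by blast
    with lam have "1 / ?lam \<le> (spectral_norm DA)\<^sup>2 + (spectral_norm DE)\<^sup>2"
      by (cases "?lam = 0") (simp_all add: divide_le_eq mult.commute)
    then show ?case by (simp add: x)
  qed
  then have "(sqrt (1 / ?lam))\<^sup>2 \<le> (dist_sing A E)\<^sup>2"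
    using lam by (intro power_mono) simp_all
  then show ?thesis using lam by simp
qed

theorem theorem5p1:
  fixes A E :: "complex^'n^'n" and l :: "nat \<Rightarrow> complex"
  assumes "regular_pencil A E"
    and "l \<in> K_set A E"
  shows "(dist_sing A E)\<^sup>2 \<ge> Max ((\<lambda>i. 1 / lambda_max (H_mat A E (l i))) ` {1..CARD('n) + 1})"
proof (rule Max.boundedI)
  fix x assume "x \<in> (\<lambda>i. 1 / lambda_max (H_mat A E (l i))) ` {1..CARD('n) + 1}"
  then obtain i where "i \<in> {1..CARD('n) + 1}" "x = 1 / lambda_max (H_mat A E (l i))" by blast
  with assms(2) show "x \<le> (dist_sing A E)\<^sup>2"
    by (simp add: K_set_def inverse_lambda_max_le_dist_sing_squared)
qed simp_all

end
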